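(* Let $V$ be a finite-dimensional complex vector space with $\dim V\geqslant 3$, equipped with a non-degenerate symmetric bilinear form, let $G=SO(V)$ be the corresponding special orthogonal group, let $m\geqslant 1$, and let $G$ act diagonally on $\mathbb{V}=V^m$ (equivalently, on $\mathbb{P}(V)^m$). Then the GIT-fan $\Psi=\{\tau(a)\mid a\in\Omega\}$ in $\mathbb{Q}^m$ of this action is obtained by cutting the cone $$\Omega=\{(x_1,\ldots,x_m)\in\mathbb{Q}^m \mid x_i\geqslant 0,\ i=1,\ldots,m\}$$ by all the hyperplanes $$\sum_{i\in I}x_i=\sum_{j\in J}x_j,$$ where $I,J\subset\{1,\ldots,m\}$, $I\neq\varnothing$, $J\neq\varnothing$, $I\cap J=\varnothing$.
   Context: Setting: $G=SO(V)$ acts diagonally on $\mathbb{V}=V^m$. For $a=(a_1,\ldots,a_m)\in\mathbb{Z}_{\geqslant 0}^m$, $P(a)\subset\mathbb{C}[\mathbb{V}]$ is the subspace of polynomials homogeneous of multidegree $a$ (degree $a_i$ in the $i$-th vector $v_i$), and $P(a)^G$ is its subspace of $G$-invariants. Weight cone: $\Omega\subset\mathbb{Q}^m$ is the cone generated by the multidegrees of a finite set of nonzero multihomogeneous generators of the algebra $\mathbb{C}[\mathbb{V}]^G$ (equivalently, by all $a$ with $P(a)^G\neq 0$). Part of the claim is that it is the cone displayed there. Orbit cone of $v\in\mathbb{V}$: the rational cone $\omega(v)=\operatorname{cone}(a\mid \exists F\in P(a)^G:\ F(v)\neq 0)\subset\mathbb{Q}^m$. There are finitely many orbit cones. GIT-cone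 of a point $a\in\Omega$: $\tau(a)=\bigcap_{v\in\mathbb{V},\ a\in\omega(v)}\omega(v)$. GIT-fan: the set of cones $\Psi=\{\tau(a)\mid a\in\Omega\}$. GIT-equivalence: for $a\in\mathbb{Z}_{\geqslant 0}^m$ put $U(a)=\{v\in\mathbb{V}\mid \exists k\in\mathbb{N},\ k\geqslant 1,\ F\in P(ka)^G:\ F(v)\neq 0\}$ (this corresponds to the semistable points of the linearized line bundle represented by $a$ on $\mathbb{P}(V)^m$). Points $a,b$ are GIT-equivalent if $U(a)=U(b)$; the GIT-equivalence classes in $\Omega$ are the relative interiors of the GIT-cones. Cutting convention: for a polyhedral cone $\Omega$ and a finite set of linear hyperplanes $\{\ell_s=0\}$, the fan obtained by cutting $\Omega$ by these hyperplanes is the collection of all cones $F\cap\bigcap_s C_s$, where $F$ is a face of $\Omega$ (possibly $\Omega$ itself) and each $C_s$ is one of $\{\ell_s\geqslant 0\}$, $\{\ell_s\leqslant 0\}$, $\{\ell_s=0\}$. *)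

theory Defs
  imports "HOL-Analysis.Analysis" "HOL-Combinatorics.Permutations"
begin

section \<open>Rational polyhedral cones\<close>

definition rat_cone :: "(rat ^ 'm) set \<Rightarrow> (rat ^ 'm) set" where
  "rat_cone A = {(\<Sum>a\<in>S. c a *s a) | S c. finite S \<and> S \<subseteq> A \<and> (\<forall>a\<in>S. 0 \<le> c a)}"

text \<open>The faces of a polyhedral cone are its intersections with supporting hyperplanes; the zero
  functional gives the cone itself. (The library's \<^const>\<open>face_of\<close> is restricted to real vector
  spaces and also counts the empty set as a face.)\<close>

definition is_cone_face :: "(rat ^ 'm) set \<Rightarrow> (rat ^ 'm) set \<Rightarrow> bool" where
  "is_cone_face F C \<longleftrightarrow>
     (\<exists>l. Vector_Spaces.linear (*s) (*) l \<and> (\<forall>x\<in>C. 0 \<le> l x) \<and> F = {x \<in> C. l x = 0})"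

text \<open>A hyperplane is represented by a linear functional vanishing on it. If \<open>L\<close> contains both
  \<open>l\<close> and \<open>- l\<close>, the resulting collection of cones is the same as with only one of them.\<close>

definition cut_fan :: "(rat ^ 'm) set \<Rightarrow> (rat ^ 'm \<Rightarrow> rat) set \<Rightarrow> (rat ^ 'm) set set" where
  "cut_fan C L =
     {F \<inter> (\<Inter>l\<in>L. H l) | F H. is_cone_face F C \<and>
        (\<forall>l\<in>L. H l \<in> {{x. 0 \<le> l x}, {x. l x \<le> 0}, {x. l x = 0}})}"


section \<open>The diagonal action of the special orthogonal group\<close>

locale quadratic_space = finite_dimensional_vector_space scale Basis
  for scale :: "complex \<Rightarrow> 'v::ab_group_add \<Rightarrow> 'v" and Basis :: "'v set" +
  fixes B :: "'v \<Rightarrow> 'v \<Rightarrow> complex"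
  assumes B_linear_left: "\<And>y. Vector_Spaces.linear scale (*) (\<lambda>x. B x y)"
    and B_linear_right: "\<And>x. Vector_Spaces.linear scale (*) (\<lambda>y. B x y)"
    and B_sym: "\<And>x y. B x y = B y x"
    and B_nondegenerate: "\<And>x. (\<forall>y. B x y = 0) \<Longrightarrow> x = 0"
begin

text \<open>The Leibniz formula for the matrix of \<open>g\<close> in the basis \<open>Basis\<close>; for linear \<open>g\<close> the value
  does not depend on the basis.\<close>

definition endo_det :: "('v \<Rightarrow> 'v) \<Rightarrow> complex" where
  "endo_det g =
     (\<Sum>p | p permutes Basis. of_int (sign p) * (\<Prod>b\<in>Basis. representation Basis (g b) (p b)))"

definition SO :: "('v \<Rightarrow> 'v) set" where
  "SO = {g. Vector_Spaces.linear scale scale g \<and> (\<forall>x y. B (g x) (g y) = B x y) \<and> endo_det g = 1}"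

text \<open>Since the field is infinite, elements of the coordinate ring of \<open>V\<^sup>m\<close> are identified with
  polynomial functions, that is, with the algebra of functions generated by the linear forms in
  the components.\<close>

inductive poly_fun :: "('v ^ 'm \<Rightarrow> complex) \<Rightarrow> bool" where
  form: "Vector_Spaces.linear scale (*) f \<Longrightarrow> poly_fun (\<lambda>v. f (v $ i))"
| const: "poly_fun (\<lambda>v. c)"
| add: "poly_fun F \<Longrightarrow> poly_fun F' \<Longrightarrow> poly_fun (\<lambda>v. F v + F' v)"
| mult: "poly_fun F \<Longrightarrow> poly_fun F' \<Longrightarrow> poly_fun (\<lambda>v. F v * F' v)"

definition multihom :: "nat ^ 'm::finite \<Rightarrow> ('v ^ 'm \<Rightarrow> complex) set" where
  "multihom a = {F. poly_fun F \<and>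
     (\<forall>t v. F (\<chi> i. scale (t i) (v $ i)) = (\<Prod>i\<in>UNIV. t i ^ (a $ i)) * F v)}"

definition multihom_inv :: "nat ^ 'm::finite \<Rightarrow> ('v ^ 'm \<Rightarrow> complex) set" where
  "multihom_inv a = {F \<in> multihom a. \<forall>g\<in>SO. \<forall>v. F (\<chi> i. g (v $ i)) = F v}"

definition weight_cone :: "(rat ^ 'm::finite) set" where
  "weight_cone = rat_cone {\<chi> i. of_nat (a $ i) | a. \<exists>F\<in>multihom_inv a. F \<noteq> (\<lambda>v. 0)}"

definition orbit_cone :: "'v ^ 'm::finite \<Rightarrow> (rat ^ 'm) set" where
  "orbit_cone v = rat_cone {\<chi> i. of_nat (a $ i) | a. \<exists>F\<in>multihom_inv a. F v \<noteq> 0}"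

definition git_cone :: "rat ^ 'm::finite \<Rightarrow> (rat ^ 'm) set" where
  "git_cone a = \<Inter>{orbit_cone v | v. a \<in> orbit_cone v}"

definition git_fan :: "(rat ^ 'm::finite) set set" where
  "git_fan = {git_cone a | a. a \<in> weight_cone}"

end

end

theory Submission
  imports Defs "HOL-Computational_Algebra.Polynomial"
begin

text \<open>The proof computes all orbit cones. For \<open>v\<close> in \<open>V\<^sup>m\<close> call \<open>i\<close> and \<open>j\<close> adjacent if
  \<open>B (v $ i) (v $ j) \<noteq> 0\<close>; loops are allowed. A set \<open>S\<close> of pairwise nonadjacent, loopless
  vertices is a family of vectors spanning a totally isotropic subspace. With \<open>N(S)\<close> denoting
  the set of neighbours of \<open>S\<close>, the orbit cone of \<open>v\<close> is given by \<open>x \<ge> 0\<close> and by the condition,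
  for each such \<open>S\<close>, that the coordinates in \<open>S\<close> have at most the sum of those in \<open>N(S)\<close>
  (\<open>orbit_cone_eq\<close>).

  These inequalities hold by a Hilbert--Mumford argument (\<open>isotropic_degree_le\<close>): a
  one-parameter subgroup of the special orthogonal group, adapted to the isotropic span of \<open>S\<close>,
  together with a rescaling of the vectors moves \<open>v\<close> along a curve that has a limit, while an
  invariant that does not vanish at \<open>v\<close> and whose degree violates the inequality would be
  unbounded along it. In particular no generators of the ring of invariants are needed. The
  inequalities suffice by a weighted form of Hall's marriage theorem
  (\<open>symmetric_transport_plan_exists\<close>): they allow \<open>x\<close> to be written as a nonnegative combination
  of the degrees of the invariants \<open>B (v $ i) (v $ j)\<close> that do not vanish at \<open>v\<close>.

  Consequently, all orbit cones are cut out by inequalities between coordinate sums over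
  disjoint sets \<open>I\<close> and \<open>J\<close>, and in dimension at least three every such inequality is the
  decisive one for a suitable \<open>v\<close>. So the GIT-cone of \<open>a\<close> consists of the points that satisfy
  every inequality of this kind that \<open>a\<close> satisfies (\<open>git_cone_eq_sign_cone\<close>), and these cones
  form the cut fan (\<open>sign_cones_eq_cut_fan\<close>).\<close>

section \<open>Transport plans and Hall's condition\<close>

text \<open>The weighted form of Hall's marriage theorem: supplies \<open>a\<close> can be shipped along the edges \<open>E\<close>
  within the demands \<open>b\<close>. As in Rado's proof, as much as possible is sent along one edge
  \<open>(i0, j0)\<close>, keeping Hall's condition. What stops the flow is an exhausted supply, an exhausted
  demand, or a set \<open>S\<close> that has become tight; a tight set decouples the problem, and every edge
  from outside \<open>S\<close> into its neighbourhood, \<open>(i0, j0)\<close> among them, can be deleted. In each case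
  the number of edges plus the number of nonzero supplies and demands drops.\<close>

lemma transport_plan_exists:
  fixes E :: "('i::finite \<times> 'j::finite) set" and a :: "'i \<Rightarrow> 'a::linordered_field" and b :: "'j \<Rightarrow> 'a"
  assumes "\<And>i. 0 \<le> a i" and "\<And>j. 0 \<le> b j" and "\<And>S. sum a S \<le> sum b (E `` S)"
  shows "\<exists>x. (\<forall>i j. 0 \<le> x i j) \<and> (\<forall>i j. (i, j) \<notin> E \<longrightarrow> x i j = 0) \<and>
             (\<forall>i. (\<Sum>j\<in>UNIV. x i j) = a i) \<and> (\<forall>j. (\<Sum>i\<in>UNIV. x i j) \<le> b j)"
  using assms
proof (induction "card E + card {i. a i \<noteq> 0} + card {j. b j \<noteq> 0}" arbitrary: E a b rule: less_induct)
  case less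
  note a0 = less.prems(1) and b0 = less.prems(2) and hall = less.prems(3)
  show ?case
  proof (cases "\<forall>i. a i = 0")
    case True
    then show ?thesis
      using b0 by (intro exI[of _ "\<lambda>i j. 0"]) auto
  next
    case False
    then obtain i0 where "a i0 \<noteq> 0" by blast
    then have ai0: "0 < a i0" using a0[of i0] by simp
    have "0 < sum b (E `` {i0})" using hall[of "{i0}"] ai0 by simp
    then obtain j0 where j0: "(i0, j0) \<in> E" and bj0: "0 < b j0"
      using sum_nonpos[of "E `` {i0}" b] by (force simp: not_less)
    \<comment> \<open>The sets whose slack in Hall's condition shrinks when flow is sent along \<open>(i0, j0)\<close>.\<close>
    define T where "T = {S. i0 \<notin> S \<and> j0 \<in> E `` S}"
    define slack where "slack = (\<lambda>S. sum b (E `` S) - sum a S)"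
    define eps where "eps = Min (insert (a i0) (insert (b j0) (slack ` T)))"
    have eps_in: "eps \<in> insert (a i0) (insert (b j0) (slack ` T))"
      unfolding eps_def by (rule Min_in) auto
    have eps_le: "eps \<le> a i0" "eps \<le> b j0" "\<And>S. S \<in> T \<Longrightarrow> eps \<le> slack S"
      unfolding eps_def by (auto intro!: Min_le simp del: Min_insert)
    have eps0: "0 \<le> eps"
      using eps_in ai0 bj0 hall by (auto simp: slack_def)
    define a' where "a' = (\<lambda>i. a i - (if i = i0 then eps else 0))"
    define b' where "b' = (\<lambda>j. b j - (if j = j0 then eps else 0))"
    have suma: "sum a' S = sum a S - (if i0 \<in> S then eps else 0)" for S
      unfolding a'_def by (simp add: sum_subtractf)
    have sumb: "sum b' S = sum b S - (if j0 \<in> S then eps else 0)" for S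
      unfolding b'_def by (simp add: sum_subtractf)
    have a'0: "0 \<le> a' i" for i using a0[of i] eps_le(1) by (simp add: a'_def)
    have b'0: "0 \<le> b' j" for j using b0[of j] eps_le(2) by (simp add: b'_def)
    have hall': "sum a' S \<le> sum b' (E `` S)" for S
    proof (cases "S \<in> T")
      case True
      then show ?thesis using eps_le(3)[OF True]
        unfolding suma sumb by (simp add: T_def slack_def)
    next
      case False
      then show ?thesis using hall[of S] j0 eps0
        unfolding suma sumb by (auto simp: T_def)
    qed
    have suppa: "{i. a' i \<noteq> 0} \<subseteq> {i. a i \<noteq> 0}" using ai0 by (auto simp: a'_def)
    have suppb: "{j. b' j \<noteq> 0} \<subseteq> {j. b j \<noteq> 0}" using bj0 by (auto simp: b'_def)
    have carda: "card {i. a' i \<noteq> 0} \<le> card {i. a i \<noteq> 0}" and cardb: "card {j. b' j \<noteq> 0} \<le> card {j. b j \<noteq> 0}"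
      using suppa suppb by (simp_all add: card_mono)
    have "\<exists>x. (\<forall>i j. 0 \<le> x i j) \<and> (\<forall>i j. (i, j) \<notin> E \<longrightarrow> x i j = 0) \<and>
             (\<forall>i. (\<Sum>j\<in>UNIV. x i j) = a' i) \<and> (\<forall>j. (\<Sum>i\<in>UNIV. x i j) \<le> b' j)"
    proof (cases "eps = a i0 \<or> eps = b j0")
      case True
      have "card {i. a' i \<noteq> 0} < card {i. a i \<noteq> 0} \<or> card {j. b' j \<noteq> 0} < card {j. b j \<noteq> 0}"
        using True
      proof
        assume "eps = a i0"
        then have "{i. a' i \<noteq> 0} \<subset> {i. a i \<noteq> 0}"
          using suppa ai0 by (auto simp: a'_def)
        then show ?thesis by (simp add: psubset_card_mono)
      next
        assume "eps = b j0"
        then have "{j. b' j \<noteq> 0} \<subset> {j. b j \<noteq> 0}"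
          using suppb bj0 by (auto simp: b'_def)
        then show ?thesis by (simp add: psubset_card_mono)
      qed
      then show ?thesis
        using carda cardb by (intro less.hyps a'0 b'0 hall') auto
    next
      case False
      then obtain S where S: "S \<in> T" and "eps = slack S" using eps_in by auto
      then have tight: "sum b' (E `` S) = sum a' S"
        unfolding suma sumb by (simp add: T_def slack_def)
      define E' where "E' = E - (- S) \<times> (E `` S)"
      have "E' \<subset> E" using S j0 by (auto simp: E'_def T_def)
      then have "card E' < card E" by (simp add: psubset_card_mono)
      moreover have "sum a' R \<le> sum b' (E' `` R)" for R
      proof -
        have "sum a' R = sum a' (R \<inter> S) + sum a' (R - S)"
          by (simp add: sum.Int_Diff[of R a' S])
        also have "sum a' (R - S) = sum a' (R \<union> S) - sum a' S"
          using sum.union_disjoint[of S "R - S" a'] by (simp add: Un_commute)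
        also have "\<dots> \<le> sum b' (E `` (R \<union> S)) - sum b' (E `` S)"
          using hall'[of "R \<union> S"] tight by simp
        also have "\<dots> = sum b' (E `` R - E `` S)"
          using sum.union_disjoint[of "E `` S" "E `` R - E `` S" b'] by (simp add: Image_Un Un_commute)
        also have "sum a' (R \<inter> S) \<le> sum b' (E `` (R \<inter> S))" by (rule hall')
        also have "sum b' (E `` (R \<inter> S)) + sum b' (E `` R - E `` S)
            = sum b' (E `` (R \<inter> S) \<union> (E `` R - E `` S))"
          by (rule sum.union_disjoint[symmetric]) auto
        also have "E `` (R \<inter> S) \<union> (E `` R - E `` S) = E' `` R"
          by (auto simp: E'_def)
        finally show ?thesis by simp
      qed
      ultimately have "\<exists>x. (\<forall>i j. 0 \<le> x i j) \<and> (\<forall>i j. (i, j) \<notin> E' \<longrightarrow> x i j = 0) \<and>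
             (\<forall>i. (\<Sum>j\<in>UNIV. x i j) = a' i) \<and> (\<forall>j. (\<Sum>i\<in>UNIV. x i j) \<le> b' j)"
        using carda cardb by (intro less.hyps a'0 b'0) auto
      then show ?thesis using \<open>E' \<subset> E\<close> by blast
    qed
    then obtain x where x: "\<And>i j. 0 \<le> x i j" "\<And>i j. (i, j) \<notin> E \<Longrightarrow> x i j = 0"
      "\<And>i. (\<Sum>j\<in>UNIV. x i j) = a' i" "\<And>j. (\<Sum>i\<in>UNIV. x i j) \<le> b' j" by blast
    define y where "y = (\<lambda>i j. x i j + (if i = i0 then if j = j0 then eps else 0 else 0))"
    have "(\<Sum>j\<in>UNIV. y i j) = a i" for i
      using x(3)[of i] by (simp add: y_def sum.distrib a'_def)
    moreover have "(\<Sum>i\<in>UNIV. y i j) \<le> b j" for j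
      using x(4)[of j] by (simp add: y_def sum.distrib b'_def)
    ultimately show ?thesis
      using x(1,2) eps0 j0 by (intro exI[of _ y]) (auto simp: y_def)
  qed
qed

text \<open>For a symmetric relation, Hall's condition need only be tested on stable sets: the part \<open>R\<close> of
  \<open>S\<close> without neighbours in \<open>S\<close> is stable, its neighbourhood lies outside \<open>S\<close>, and the rest of
  \<open>S\<close> is contained in the neighbourhood of \<open>S\<close> and so is charged to itself. As total supply and
  total demand agree, the column sums are then equalities.\<close>

lemma symmetric_transport_plan_exists:
  fixes E :: "('i::finite \<times> 'i) set" and a :: "'i \<Rightarrow> 'a::linordered_field"
  assumes "sym E" and a0: "\<And>i. 0 \<le> a i"
    and stable: "\<And>S. S \<inter> E `` S = {} \<Longrightarrow> sum a S \<le> sum a (E `` S)"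
  shows "\<exists>x. (\<forall>i j. 0 \<le> x i j) \<and> (\<forall>i j. (i, j) \<notin> E \<longrightarrow> x i j = 0) \<and>
             (\<forall>i. (\<Sum>j\<in>UNIV. x i j) = a i) \<and> (\<forall>j. (\<Sum>i\<in>UNIV. x i j) = a j)"
proof -
  have hall: "sum a S \<le> sum a (E `` S)" for S
  proof -
    define R where "R = S - E `` S"
    have R: "E `` R \<inter> S = {}" using \<open>sym E\<close> by (auto simp: R_def dest: symD)
    have "sum a S = sum a (S \<inter> E `` S) + sum a R"
      unfolding R_def by (rule sum.Int_Diff) simp
    also have "sum a R \<le> sum a (E `` R)"
      using R by (intro stable) (auto simp: R_def)
    also have "sum a (S \<inter> E `` S) + sum a (E `` R) = sum a ((S \<inter> E `` S) \<union> E `` R)"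
      using R by (intro sum.union_disjoint[symmetric]) auto
    also have "\<dots> \<le> sum a (E `` S)"
      using a0 by (intro sum_mono2) (auto simp: R_def)
    finally show ?thesis by simp
  qed
  obtain x where x: "\<forall>i j. 0 \<le> x i j" "\<forall>i j. (i, j) \<notin> E \<longrightarrow> x i j = 0"
      "\<forall>i. (\<Sum>j\<in>UNIV. x i j) = a i" "\<forall>j. (\<Sum>i\<in>UNIV. x i j) \<le> a j"
    using transport_plan_exists[OF a0 a0 hall] by blast
  have "(\<Sum>j\<in>UNIV. a j - (\<Sum>i\<in>UNIV. x i j)) = 0"
    using x(3) sum.swap[of "\<lambda>i j. x i j" UNIV UNIV] by (simp add: sum_subtractf)
  then have "\<forall>j. (\<Sum>i\<in>UNIV. x i j) = a j"
    using x(4) by (subst (asm) sum_nonneg_eq_0_iff) auto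
  then show ?thesis using x by blast
qed

section \<open>Rational cones and the cut orthant\<close>

lemma rat_cone_sum:
  assumes "finite K" and "\<And>k. k \<in> K \<Longrightarrow> 0 \<le> c k" and "\<And>k. k \<in> K \<Longrightarrow> f k \<in> A"
  shows "(\<Sum>k\<in>K. c k *s f k) \<in> rat_cone A"
proof -
  define d where "d = (\<lambda>a. \<Sum>k | k \<in> K \<and> f k = a. c k)"
  have "(\<Sum>k\<in>K. c k *s f k) = (\<Sum>a\<in>f ` K. \<Sum>k | k \<in> K \<and> f k = a. c k *s f k)"
    by (rule sum.image_gen[OF \<open>finite K\<close>])
  also have "\<dots> = (\<Sum>a\<in>f ` K. d a *s a)"
    by (intro sum.cong) (auto simp: d_def vec.scale_sum_left)
  finally have "(\<Sum>k\<in>K. c k *s f k) = (\<Sum>a\<in>f ` K. d a *s a)" .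
  moreover have "\<forall>a\<in>f ` K. 0 \<le> d a" unfolding d_def using assms(2) by (auto intro!: sum_nonneg)
  moreover have "finite (f ` K)" "f ` K \<subseteq> A" using assms by auto
  ultimately show ?thesis unfolding rat_cone_def by blast
qed

lemma rat_cone_mono: "A \<subseteq> A' \<Longrightarrow> rat_cone A \<subseteq> rat_cone A'"
  unfolding rat_cone_def by blast

lemma rat_cone_sum_le:
  fixes A :: "(rat ^ 'm::finite) set"
  assumes x: "x \<in> rat_cone A" and le: "\<And>a. a \<in> A \<Longrightarrow> (\<Sum>i\<in>I. a $ i) \<le> (\<Sum>j\<in>J. a $ j)"
  shows "(\<Sum>i\<in>I. x $ i) \<le> (\<Sum>j\<in>J. x $ j)"
proof -
  obtain S c where S: "S \<subseteq> A" "\<forall>a\<in>S. 0 \<le> c a" and x_eq: "x = (\<Sum>a\<in>S. c a *s a)"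
    using x unfolding rat_cone_def by blast
  have swap: "(\<Sum>i\<in>R. x $ i) = (\<Sum>a\<in>S. c a * (\<Sum>i\<in>R. a $ i))" for R
    unfolding x_eq by (subst sum_distrib_left, subst sum.swap) simp
  show ?thesis unfolding swap
    using S le by (intro sum_mono mult_left_mono) auto
qed

text \<open>A point in the relative interior of a cone \<open>C\<close> with respect to a finite set of functionals,
  each semidefinite on \<open>C\<close>. If a further functional \<open>l\<close> vanishes at the point \<open>a\<close> found so far, but
  not on \<open>C\<close>, one adds to \<open>a\<close> a point of \<open>C\<close> where \<open>l\<close> does not vanish;
  semidefiniteness makes the values of a functional at \<open>a\<close> and at the added point agree in sign,
  so that none that was nonzero at \<open>a\<close> becomes zero.\<close>

lemma exists_generic_point:
  fixes K :: "('a::ab_group_add \<Rightarrow> 'b::linordered_idom) set"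
  assumes "finite K" and "C \<noteq> {}" and C_add: "\<And>x y. x \<in> C \<Longrightarrow> y \<in> C \<Longrightarrow> x + y \<in> C"
    and additive: "\<And>l x y. l \<in> K \<Longrightarrow> l (x + y) = l x + l y"
    and semidef: "\<And>l. l \<in> K \<Longrightarrow> (\<forall>x\<in>C. 0 \<le> l x) \<or> (\<forall>x\<in>C. l x \<le> 0)"
  shows "\<exists>a\<in>C. \<forall>l\<in>K. l a = 0 \<longrightarrow> (\<forall>x\<in>C. l x = 0)"
  using assms(1,4,5)
proof (induction K rule: finite_induct)
  case empty
  then show ?case using \<open>C \<noteq> {}\<close> by blast
next
  case (insert l K)
  then obtain a where a: "a \<in> C" "\<forall>k\<in>K. k a = 0 \<longrightarrow> (\<forall>x\<in>C. k x = 0)" by auto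
  show ?case
  proof (cases "l a = 0 \<longrightarrow> (\<forall>x\<in>C. l x = 0)")
    case True
    then show ?thesis using a by blast
  next
    case False
    then obtain w where w: "w \<in> C" "l w \<noteq> 0" and la: "l a = 0" by blast
    have "\<forall>x\<in>C. k x = 0" if k: "k \<in> K" "k (a + w) = 0" for k
    proof -
      have "k a + k w = 0" using k insert.prems(1)[of k a w] by simp
      moreover have "(0 \<le> k a \<and> 0 \<le> k w) \<or> (k a \<le> 0 \<and> k w \<le> 0)"
        using insert.prems(2)[of k] k(1) a(1) w(1) by blast
      ultimately have "k a = 0" by linarith
      then show ?thesis using a k by blast
    qed
    moreover have "l (a + w) \<noteq> 0" using insert.prems(1)[of l a w] la w by simp
    ultimately show ?thesis using C_add[OF a(1) w(1)] by blast
  qed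
qed

text \<open>The cone of the cut fan through \<open>a\<close> in its relative interior, written as the solution set of
  the weak inequalities that hold at \<open>a\<close>. Letting \<open>I\<close> or \<open>J\<close> be empty makes the coordinate
  hyperplanes part of the same family as the cutting hyperplanes, so these inequalities also
  record the face of the orthant that contains \<open>a\<close>.\<close>

definition sign_cone :: "rat ^ 'm::finite \<Rightarrow> (rat ^ 'm) set" where
  "sign_cone a = {x. \<forall>I J. I \<inter> J = {} \<longrightarrow> (\<Sum>i\<in>I. a $ i) \<le> (\<Sum>j\<in>J. a $ j) \<longrightarrow>
                      (\<Sum>i\<in>I. x $ i) \<le> (\<Sum>j\<in>J. x $ j)}"

lemma sign_coneD:
  "x \<in> sign_cone a \<Longrightarrow> I \<inter> J = {} \<Longrightarrow> (\<Sum>i\<in>I. a $ i) \<le> (\<Sum>j\<in>J. a $ j) \<Longrightarrow>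
    (\<Sum>i\<in>I. x $ i) \<le> (\<Sum>j\<in>J. x $ j)"
  by (simp add: sign_cone_def)

lemma sign_cone_nonneg:
  assumes "x \<in> sign_cone a" and "0 \<le> a $ i"
  shows "0 \<le> x $ i"
  using sign_coneD[OF assms(1), of "{}" "{i}"] assms(2) by simp

lemma sign_cone_zero:
  assumes "x \<in> sign_cone a" and "a $ i = 0"
  shows "x $ i = 0"
  using sign_coneD[OF assms(1), of "{}" "{i}"] sign_coneD[OF assms(1), of "{i}" "{}"] assms(2) by simp

lemma linear_functional_coordinates:
  assumes "Vector_Spaces.linear (*s) (*) (l :: 'a::field ^ 'm::finite \<Rightarrow> 'a)"
  shows "l x = (\<Sum>i\<in>UNIV. x $ i * l (axis i 1))"
proof -
  interpret l: Vector_Spaces.linear "(*s)" "(*)" l by fact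
  have "l x = l (\<Sum>i\<in>UNIV. x $ i *s axis i 1)" by (simp add: basis_expansion)
  then show ?thesis by (simp add: l.sum l.scale)
qed

text \<open>A cone of the cut fan is the sign cone of any of its relatively interior points: there every
  functional of the arrangement that vanishes at the point vanishes on the whole cone.
  Conversely, a sign cone lies in the face of the orthant whose vanishing coordinates are those
  of \<open>a\<close>, on the sides given by the signs of the functionals at \<open>a\<close>.\<close>

lemma sign_cones_eq_cut_fan:
  fixes \<Omega> :: "(rat ^ 'm::finite) set"
  defines "\<Omega> \<equiv> {x. \<forall>i. 0 \<le> x $ i}"
  defines "L \<equiv> {(\<lambda>x. (\<Sum>i\<in>I. x $ i) - (\<Sum>j\<in>J. x $ j)) | I J. I \<noteq> {} \<and> J \<noteq> {} \<and> I \<inter> J = {}}"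
  shows "{sign_cone a | a. a \<in> \<Omega>} = cut_fan \<Omega> L" (is "?S = _")
proof -
  have L_intro: "(\<lambda>x. (\<Sum>i\<in>I. x $ i) - (\<Sum>j\<in>J. x $ j)) \<in> L"
    if "I \<noteq> {}" "J \<noteq> {}" "I \<inter> J = {}" for I J
    using that unfolding L_def by blast
  have L_elim: thesis
    if "l \<in> L" "\<And>I J. l = (\<lambda>x. (\<Sum>i\<in>I. x $ i) - (\<Sum>j\<in>J. x $ j)) \<Longrightarrow> I \<inter> J = {} \<Longrightarrow> thesis" for l thesis
    using that unfolding L_def by blast
  show ?thesis
  proof (intro equalityI subsetI)
  fix T assume "T \<in> ?S"
  then obtain a where T: "T = sign_cone a" and a: "\<And>i. 0 \<le> a $ i" by (auto simp: \<Omega>_def)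
  \<comment> \<open>The face of the orthant on which the coordinates vanishing at \<open>a\<close> vanish.\<close>
  define l0 :: "rat ^ 'm \<Rightarrow> rat" where "l0 = (\<lambda>x. \<Sum>i | a $ i = 0. x $ i)"
  define F where "F = {x \<in> \<Omega>. l0 x = 0}"
  have F: "x \<in> F \<longleftrightarrow> (\<forall>i. 0 \<le> x $ i) \<and> (\<forall>i. a $ i = 0 \<longrightarrow> x $ i = 0)" for x
    by (auto simp: F_def \<Omega>_def l0_def sum_nonneg_eq_0_iff)
  have "Vector_Spaces.linear (*s) (*) l0"
    unfolding Vector_Spaces.linear_iff l0_def
    by (auto simp: sum.distrib sum_distrib_left vec.vector_space_axioms)
       (unfold_locales, auto simp: algebra_simps)
  then have face: "is_cone_face F \<Omega>"
    unfolding is_cone_face_def F_def by (auto simp: \<Omega>_def l0_def intro!: exI[of _ l0] sum_nonneg)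
  define H where "H = (\<lambda>l::rat ^ 'm \<Rightarrow> rat. if l a = 0 then {x. l x = 0}
                          else if 0 \<le> l a then {x. 0 \<le> l x} else {x. l x \<le> 0})"
  have "T = F \<inter> (\<Inter>l\<in>L. H l)"
  proof (intro equalityI subsetI)
    fix x assume "x \<in> T"
    then have x: "x \<in> sign_cone a" by (simp add: T)
    have "x \<in> H l" if L: "l \<in> L" for l
    proof -
      obtain I J where l: "l = (\<lambda>x. (\<Sum>i\<in>I. x $ i) - (\<Sum>j\<in>J. x $ j))" and IJ: "I \<inter> J = {}"
        using L by (rule L_elim)
      then show ?thesis
        using sign_coneD[OF x, of I J] sign_coneD[OF x, of J I] IJ Int_commute[of J I]
          by (auto simp: H_def)
    qed
    then show "x \<in> F \<inter> (\<Inter>l\<in>L. H l)"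
      using sign_cone_nonneg[OF x] sign_cone_zero[OF x] a by (auto simp: F)
  next
    fix x assume x: "x \<in> F \<inter> (\<Inter>l\<in>L. H l)"
    have "(\<Sum>i\<in>I. x $ i) \<le> (\<Sum>j\<in>J. x $ j)"
      if IJ: "I \<inter> J = {}" and le: "(\<Sum>i\<in>I. a $ i) \<le> (\<Sum>j\<in>J. a $ j)" for I J
    proof -
      consider "I = {}" | "J = {}" | "I \<noteq> {}" "J \<noteq> {}" by blast
      then show ?thesis
      proof cases
        case 1
        then show ?thesis using x by (auto simp: F intro!: sum_nonneg)
      next
        case 2
        then have "(\<Sum>i\<in>I. a $ i) = 0" using le a by (intro antisym) (auto intro: sum_nonneg)
        then have "\<forall>i\<in>I. a $ i = 0" using a by (subst (asm) sum_nonneg_eq_0_iff) auto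
        then have "(\<Sum>i\<in>I. x $ i) = 0" using x by (intro sum.neutral) (auto simp: F)
        then show ?thesis using 2 by simp
      next
        case 3
        let ?l = "\<lambda>x::rat ^ 'm. (\<Sum>i\<in>I. x $ i) - (\<Sum>j\<in>J. x $ j)"
        have "?l \<in> L" using 3 IJ by (rule L_intro)
        then have "x \<in> H ?l" using x by blast
        then show ?thesis using le by (auto simp: H_def split: if_splits)
      qed
    qed
    then show "x \<in> T" by (simp add: T sign_cone_def)
  qed
  moreover have "\<forall>l\<in>L. H l \<in> {{x. 0 \<le> l x}, {x. l x \<le> 0}, {x. l x = 0}}"
    by (auto simp: H_def)
  ultimately show "T \<in> cut_fan \<Omega> L" unfolding cut_fan_def using face by blast
next
  fix T assume "T \<in> cut_fan \<Omega> L"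
  then obtain F H where T: "T = F \<inter> (\<Inter>l\<in>L. H l)" and face: "is_cone_face F \<Omega>"
    and sides: "\<forall>l\<in>L. H l \<in> {{x. 0 \<le> l x}, {x. l x \<le> 0}, {x. l x = 0}}"
    unfolding cut_fan_def mem_Collect_eq by (elim exE conjE) (rule that)
  have H: "H l = {x. 0 \<le> l x} \<or> H l = {x. l x \<le> 0} \<or> H l = {x. l x = 0}" if "l \<in> L" for l
    using bspec[OF sides that] by simp
  obtain f where f: "Vector_Spaces.linear (*s) (*) f" and f0: "\<forall>x\<in>\<Omega>. 0 \<le> f x"
    and F: "F = {x \<in> \<Omega>. f x = 0}"
    using face unfolding is_cone_face_def by blast
  have f_add: "f (x + y) = f x + f y" for x y using f by (simp add: Vector_Spaces.linear_iff)
  then have f_zero: "f 0 = 0" by (metis add_cancel_right_right)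
  have f_axis: "0 \<le> f (axis i 1)" for i
    using f0 by (auto simp: \<Omega>_def axis_def)
  \<comment> \<open>The coordinates are included because they determine the face of the orthant.\<close>
  define K where "K = L \<union> range (\<lambda>i (x :: rat ^ 'm). x $ i)"
  have LK: "l \<in> K" if "l \<in> L" for l using that by (simp add: K_def)
  have add: "l (x + y) = l x + l y" if "l \<in> K" for l x y
    using that by (auto simp: K_def sum.distrib elim: L_elim)
  have "finite L"
    by (rule finite_subset[of _ "(\<lambda>(I, J). \<lambda>x. (\<Sum>i\<in>I. x $ i) - (\<Sum>j\<in>J. x $ j)) ` UNIV"]) (auto simp: L_def)
  then have "finite K" by (simp add: K_def)
  moreover have zero: "l 0 = 0" if "l \<in> K" for l using add[OF that, of 0 0] by simp
  have "0 \<in> T"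
  proof -
    have "0 \<in> H l" if "l \<in> L" for l
      using H[OF that] zero[OF LK[OF that]] by (elim disjE) simp_all
    then show ?thesis by (simp add: T F \<Omega>_def f_zero)
  qed
  then have "T \<noteq> {}" by blast
  moreover have "x + y \<in> T" if "x \<in> T" "y \<in> T" for x y
  proof -
    have "x + y \<in> H l" if l: "l \<in> L" for l
    proof -
      have "x \<in> H l" "y \<in> H l" using \<open>x \<in> T\<close> \<open>y \<in> T\<close> l unfolding T by blast+
      moreover have "l (x + y) = l x + l y" using l by (intro add LK)
      ultimately show ?thesis using H[OF l] by (elim disjE) simp_all
    qed
    then show ?thesis using that by (simp add: T F \<Omega>_def f_add)
  qed
  moreover have "(\<forall>x\<in>T. 0 \<le> l x) \<or> (\<forall>x\<in>T. l x \<le> 0)" if "l \<in> K" for l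
  proof (cases "l \<in> L")
    case True
    then have "T \<subseteq> H l" unfolding T by blast
    then show ?thesis using H[OF True] by (elim disjE) (simp_all add: subset_iff)
  next
    case False
    then obtain i where "l = (\<lambda>x. x $ i)" using \<open>l \<in> K\<close> by (auto simp: K_def)
    then show ?thesis by (simp add: T F \<Omega>_def)
  qed
  ultimately obtain a where a: "a \<in> T" and generic: "\<And>l x. l \<in> K \<Longrightarrow> l a = 0 \<Longrightarrow> x \<in> T \<Longrightarrow> l x = 0"
    using exists_generic_point[of K T] add by blast
  have a0: "\<And>i. 0 \<le> a $ i" using a by (simp add: T F \<Omega>_def)
  have "T = sign_cone a"
  proof (intro equalityI subsetI)
    fix x assume x: "x \<in> T"
    have "(\<Sum>i\<in>I. x $ i) \<le> (\<Sum>j\<in>J. x $ j)"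
      if IJ: "I \<inter> J = {}" and le: "(\<Sum>i\<in>I. a $ i) \<le> (\<Sum>j\<in>J. a $ j)" for I J
    proof -
      consider "I = {}" | "J = {}" | "I \<noteq> {}" "J \<noteq> {}" by blast
      then show ?thesis
      proof cases
        case 1
        then show ?thesis using x by (auto simp: T F \<Omega>_def intro!: sum_nonneg)
      next
        case 2
        then have "(\<Sum>i\<in>I. a $ i) = 0" using le a0 by (intro antisym) (auto intro: sum_nonneg)
        then have "\<forall>i\<in>I. a $ i = 0" using a0 by (subst (asm) sum_nonneg_eq_0_iff) auto
        then have "(\<Sum>i\<in>I. x $ i) = 0"
          using generic[of "\<lambda>x. x $ _", OF _ _ x] by (intro sum.neutral) (auto simp: K_def)
        then show ?thesis using 2 by simp
      next
        case 3
        let ?l = "\<lambda>x::rat ^ 'm. (\<Sum>i\<in>I. x $ i) - (\<Sum>j\<in>J. x $ j)"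
        have l: "?l \<in> L" using 3 IJ by (rule L_intro)
        then have "x \<in> H ?l" "a \<in> H ?l" using x a unfolding T by blast+
        moreover have "?l a = 0 \<Longrightarrow> ?l x = 0"
          using generic[of ?l, OF _ _ x] l unfolding K_def by blast
        ultimately show ?thesis using H[OF l] le by (elim disjE) simp_all
      qed
    qed
    then show "x \<in> sign_cone a" by (simp add: sign_cone_def)
  next
    fix x assume x: "x \<in> sign_cone a"
    have x0: "0 \<le> x $ i" for i using sign_cone_nonneg[OF x a0] .
    have "f a = (\<Sum>i\<in>UNIV. a $ i * f (axis i 1))"
      by (rule linear_functional_coordinates[OF f])
    moreover have "f a = 0" using a by (simp add: T F)
    ultimately have "\<forall>i. a $ i * f (axis i 1) = 0"
      using a0 f_axis by (subst (asm) eq_commute) (simp add: sum_nonneg_eq_0_iff)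
    then have "\<forall>i. x $ i * f (axis i 1) = 0"
      using sign_cone_zero[OF x] by (auto simp: mult_eq_0_iff)
    then have "f x = 0"
      unfolding linear_functional_coordinates[OF f, of x]
      by (intro sum.neutral) blast
    then have "x \<in> F" using x0 by (simp add: F \<Omega>_def)
    moreover have "x \<in> H l" if l: "l \<in> L" for l
    proof -
      obtain I J where l_eq: "l = (\<lambda>x. (\<Sum>i\<in>I. x $ i) - (\<Sum>j\<in>J. x $ j))" and IJ: "I \<inter> J = {}"
        using l by (rule L_elim)
      have "a \<in> H l" using a l unfolding T by blast
      then show ?thesis
        using H[OF l] sign_coneD[OF x, of I J] sign_coneD[OF x, of J I] IJ Int_commute[of J I]
        by (elim disjE) (simp_all add: l_eq)
    qed
    ultimately show "x \<in> T" unfolding T by blast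
  qed
  then show "T \<in> ?S" using a0 by (auto simp: \<Omega>_def)
  qed
qed

section \<open>Determinants of endomorphisms\<close>

lemma leibniz_sum_repeated_row:
  fixes M :: "'b \<Rightarrow> 'b \<Rightarrow> 'a::{idom, ring_char_0}"
  assumes "finite S" and ij: "i \<in> S" "j \<in> S" "i \<noteq> j" and eq: "M i = M j"
  shows "(\<Sum>p | p permutes S. of_int (sign p) * (\<Prod>b\<in>S. M b (p b))) = 0"
proof -
  let ?t = "Transposition.transpose i j"
  have t: "?t permutes S" using ij by (simp add: permutes_swap_id)
  let ?f = "\<lambda>p. of_int (sign p) * (\<Prod>b\<in>S. M b (p b))"
  have "sum ?f {p. p permutes S} = (\<Sum>p | p permutes S. ?f (p \<circ> ?t))"
    by (rule sum_permutations_compose_right[OF t])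
  also have "\<dots> = (\<Sum>p | p permutes S. - ?f p)"
  proof (rule sum.cong[OF refl])
    fix p assume "p \<in> {p. p permutes S}"
    then have "permutation p" using \<open>finite S\<close> permutation_permutes by blast
    then have "sign (p \<circ> ?t) = - sign p"
      using ij by (simp add: sign_compose permutation_swap_id sign_swap_id)
    moreover have "(\<Prod>b\<in>S. M b ((p \<circ> ?t) b)) = (\<Prod>b\<in>S. M (?t b) (p (?t b)))"
      using eq by (intro prod.cong) (auto simp: Transposition.transpose_def)
    moreover have "\<dots> = (\<Prod>b\<in>S. M b (p b))"
      using prod.permute[OF t, of "\<lambda>b. M b (p b)"] by (simp add: o_def)
    ultimately show "?f (p \<circ> ?t) = - ?f p" by simp
  qed
  finally have "2 * sum ?f {p. p permutes S} = 0" by (simp add: sum_negf)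
  then show ?thesis by simp
qed

lemma leibniz_sum_permuted_rows:
  fixes M :: "'b \<Rightarrow> 'b \<Rightarrow> 'a::comm_ring_1"
  assumes "finite S" and q: "q permutes S"
  shows "(\<Sum>p | p permutes S. of_int (sign p) * (\<Prod>b\<in>S. M (q b) (p b)))
       = of_int (sign q) * (\<Sum>p | p permutes S. of_int (sign p) * (\<Prod>b\<in>S. M b (p b)))"
proof -
  let ?f = "\<lambda>p. of_int (sign p) * (\<Prod>b\<in>S. M (q b) (p b))"
  have "sum ?f {p. p permutes S} = (\<Sum>p | p permutes S. ?f (p \<circ> q))"
    by (rule sum_permutations_compose_right[OF q])
  also have "\<dots> = (\<Sum>p | p permutes S. of_int (sign q) * (of_int (sign p) * (\<Prod>b\<in>S. M b (p b))))"
  proof (rule sum.cong[OF refl])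
    fix p assume "p \<in> {p. p permutes S}"
    then have "permutation p" "permutation q" using \<open>finite S\<close> q permutation_permutes by blast+
    then have "sign (p \<circ> q) = sign q * sign p" by (simp add: sign_compose)
    moreover have "(\<Prod>b\<in>S. M (q b) ((p \<circ> q) b)) = (\<Prod>b\<in>S. M b (p b))"
      using prod.permute[OF q, of "\<lambda>b. M b (p b)"] by (simp add: o_def)
    ultimately show "?f (p \<circ> q) = of_int (sign q) * (of_int (sign p) * (\<Prod>b\<in>S. M b (p b)))"
      by (simp add: mult.assoc)
  qed
  finally show ?thesis by (simp add: sum_distrib_left)
qed

text \<open>Multiplicativity of the determinant in Leibniz form, for matrices indexed by a finite set.
  Expanding the product of row sums gives one term for every choice \<open>f\<close> of a row of \<open>M\<close> for each
  row of the product; a choice with a repeated row contributes nothing, and an injective choice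
  is a permutation of the rows of \<open>M\<close>.\<close>

lemma leibniz_sum_product:
  fixes M N :: "'b \<Rightarrow> 'b \<Rightarrow> 'a::{idom, ring_char_0}"
  assumes S: "finite S"
  shows "(\<Sum>p | p permutes S. of_int (sign p) * (\<Prod>b\<in>S. \<Sum>c\<in>S. N b c * M c (p b)))
       = (\<Sum>p | p permutes S. of_int (sign p) * (\<Prod>b\<in>S. M b (p b)))
       * (\<Sum>p | p permutes S. of_int (sign p) * (\<Prod>b\<in>S. N b (p b)))" (is "?L = ?DM * ?DN")
proof -
  let ?P = "{p. p permutes S}" and ?F = "S \<rightarrow>\<^sub>E S"
  define R where "R = (\<lambda>f. \<Sum>p\<in>?P. of_int (sign p) * (\<Prod>b\<in>S. M (f b) (p b)))"
  have "?L = (\<Sum>p\<in>?P. \<Sum>f\<in>?F. of_int (sign p) * ((\<Prod>b\<in>S. N b (f b)) * (\<Prod>b\<in>S. M (f b) (p b))))"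
    by (simp add: prod_sum_PiE S prod.distrib sum_distrib_left)
  also have "\<dots> = (\<Sum>f\<in>?F. (\<Prod>b\<in>S. N b (f b)) * R f)"
    unfolding R_def by (subst sum.swap) (simp add: sum_distrib_left mult_ac)
  also have "\<dots> = (\<Sum>f | f \<in> ?F \<and> inj_on f S. (\<Prod>b\<in>S. N b (f b)) * R f)"
  proof (rule sum.mono_neutral_right)
    show "finite ?F" using S by (simp add: finite_PiE)
    show "\<forall>f\<in>?F - {f. f \<in> ?F \<and> inj_on f S}. (\<Prod>b\<in>S. N b (f b)) * R f = 0"
    proof
      fix f assume "f \<in> ?F - {f. f \<in> ?F \<and> inj_on f S}"
      then obtain i j where "i \<in> S" "j \<in> S" "i \<noteq> j" "f i = f j" by (auto simp: inj_on_def)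
      then have "R f = 0"
        unfolding R_def using leibniz_sum_repeated_row[OF S, of i j "\<lambda>b. M (f b)"] by simp
      then show "(\<Prod>b\<in>S. N b (f b)) * R f = 0" by simp
    qed
  qed auto
  also have "\<dots> = (\<Sum>q\<in>?P. (\<Prod>b\<in>S. N b (q b)) * R q)"
  proof (rule sum.reindex_bij_witness[of _ "\<lambda>q. restrict q S" "\<lambda>f x. if x \<in> S then f x else x"])
    fix f assume f: "f \<in> {f. f \<in> ?F \<and> inj_on f S}"
    then have "bij_betw f S S"
      using S endo_inj_surj[of S f] by (auto simp: bij_betw_def PiE_def)
    then have "bij_betw (\<lambda>x. if x \<in> S then f x else x) S S"
      by (rule iffD1[OF bij_betw_cong, rotated]) simp
    then show "(\<lambda>x. if x \<in> S then f x else x) \<in> ?P"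
      by (auto intro: bij_imp_permutes)
    show "restrict (\<lambda>x. if x \<in> S then f x else x) S = f"
      using f by (auto simp: fun_eq_iff PiE_def extensional_def restrict_def)
    show "(\<Prod>b\<in>S. N b (if b \<in> S then f b else b)) * R (\<lambda>x. if x \<in> S then f x else x)
        = (\<Prod>b\<in>S. N b (f b)) * R f"
      by (simp add: R_def cong: prod.cong)
  next
    fix q assume "q \<in> ?P"
    then have q: "q permutes S" by simp
    show "restrict q S \<in> {f. f \<in> ?F \<and> inj_on f S}"
      using permutes_in_image[OF q] permutes_inj_on[OF q, of S] by (auto simp: inj_on_restrict_eq)
    show "(\<lambda>x. if x \<in> S then restrict q S x else x) = q"
      using permutes_not_in[OF q] by (auto simp: fun_eq_iff)
  qed
  also have "\<dots> = (\<Sum>q\<in>?P. ?DM * (of_int (sign q) * (\<Prod>b\<in>S. N b (q b))))"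
    unfolding R_def
    by (intro sum.cong[OF refl]) (simp add: leibniz_sum_permuted_rows[OF S] mult_ac)
  finally show ?thesis by (simp add: sum_distrib_left)
qed

context quadratic_space
begin

lemma endo_det_id: "endo_det (\<lambda>x. x) = 1"
proof -
  have "(\<Prod>b\<in>Basis. representation Basis b (p b)) = (if p = id then 1 else 0)"
    if p: "p permutes Basis" for p
  proof (cases "p = id")
    case True
    then show ?thesis by (simp add: representation_basis[OF independent_Basis])
  next
    case False
    then obtain b where b: "p b \<noteq> b" by (auto simp: fun_eq_iff)
    then have "b \<in> Basis" using permutes_not_in[OF p] by blast
    then have "\<exists>b\<in>Basis. representation Basis b (p b) = 0"
      using b by (intro bexI[of _ b]) (simp_all add: representation_basis[OF independent_Basis])
    then show ?thesis using False by (simp add: prod_zero finite_Basis)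
  qed
  then have "endo_det (\<lambda>x. x) = (\<Sum>p | p permutes Basis. if p = id then 1 else 0)"
    unfolding endo_det_def by (intro sum.cong) auto
  also have "\<dots> = 1"
    using finite_permutations[OF finite_Basis] by (subst sum.delta) (auto simp: permutes_id)
  finally show ?thesis .
qed

lemma endo_det_compose:
  assumes g: "Vector_Spaces.linear scale scale g"
  shows "endo_det (g \<circ> h) = endo_det g * endo_det h"
proof -
  let ?r = "representation Basis"
  interpret g: Vector_Spaces.linear scale scale g by fact
  have entry: "?r (g (h b)) d = (\<Sum>c\<in>Basis. ?r (h b) c * ?r (g c) d)" for b d
  proof -
    have "g (h b) = g (\<Sum>c\<in>Basis. scale (?r (h b) c) c)"
      by (simp add: sum_representation_eq independent_Basis span_Basis finite_Basis)
    also have "\<dots> = (\<Sum>c\<in>Basis. scale (?r (h b) c) (g c))"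
      by (simp add: g.sum g.scale)
    finally show ?thesis
      by (simp add: representation_sum representation_scale independent_Basis span_Basis)
  qed
  show ?thesis
    unfolding endo_det_def o_apply entry
    by (rule leibniz_sum_product[OF finite_Basis, where N = "\<lambda>b. ?r (h b)" and M = "\<lambda>c. ?r (g c)"])
qed

end

section \<open>One-parameter subgroups of the special orthogonal group\<close>

context quadratic_space
begin

lemma B_add: "B (x + x') y = B x y + B x' y" "B x (y + y') = B x y + B x y'"
  using B_linear_left[of y] B_linear_right[of x] by (auto simp: Vector_Spaces.linear_iff)

lemma B_scale: "B (scale c x) y = c * B x y" "B x (scale c y) = c * B x y"
  using B_linear_left[of y] B_linear_right[of x] by (auto simp: Vector_Spaces.linear_iff)

lemma B_zero: "B 0 y = 0" "B x 0 = 0"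
  using B_add(1)[of 0 0 y] B_add(2)[of x 0 0] by simp_all

lemma B_diff: "B (x - x') y = B x y - B x' y" "B x (y - y') = B x y - B x y'"
  using B_add(1)[of "x - x'" x' y] B_add(2)[of x "y - y'" y'] by (auto simp: algebra_simps)

lemmas B_bilinear = B_add B_scale B_zero B_diff

text \<open>By nondegeneracy an identity between vectors can be tested on the numbers \<open>B x z\<close>, where ring
  arithmetic decides it.\<close>

lemma vector_eq_if_B_eq:
  assumes "\<And>z. B x z = B y z"
  shows "x = y"
  using B_nondegenerate[of "x - y"] assms by (simp add: B_diff)

lemma linear_scale_iff:
  "Vector_Spaces.linear scale scale g \<longleftrightarrow>
    (\<forall>x y. g (x + y) = g x + g y) \<and> (\<forall>c x. g (scale c x) = scale c (g x))"
  by (simp add: Vector_Spaces.linear_iff vector_space_axioms)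

lemma SO_compose:
  assumes "g \<in> SO" and "h \<in> SO"
  shows "g \<circ> h \<in> SO"
  using assms by (auto simp: SO_def endo_det_compose linear_scale_iff)

text \<open>For a hyperbolic pair of isotropic vectors \<open>e\<close>, \<open>f\<close> with \<open>B e f = 1\<close>, the linear map with
  \<open>e \<mapsto> s e\<close> and \<open>f \<mapsto> f / s\<close> that fixes the orthogonal complement of both pointwise.\<close>

definition hyperbolic_scaling :: "'v \<Rightarrow> 'v \<Rightarrow> complex \<Rightarrow> 'v \<Rightarrow> 'v" where
  "hyperbolic_scaling e f s x = x + scale ((s - 1) * B x f) e + scale ((inverse s - 1) * B x e) f"

text \<open>The determinant is \<open>1\<close> by multiplicativity alone: the involution \<open>\<sigma>\<close> exchanging \<open>e\<close> and \<open>f\<close>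
  conjugates the scaling by \<open>1 / r\<close> into the scaling by \<open>r\<close>, so both have the same determinant.
  Their product is the identity, so this determinant has square \<open>1\<close>, and the scaling by
  \<open>s = r * r\<close> is the square of the scaling by \<open>r\<close>.\<close>

lemma hyperbolic_scaling_in_SO:
  assumes ee: "B e e = 0" and ff: "B f f = 0" and ef: "B e f = 1" and "s \<noteq> 0"
  shows "hyperbolic_scaling e f s \<in> SO"
proof -
  let ?h = "hyperbolic_scaling e f"
  have fe: "B f e = 1" using ef B_sym by simp
  note dual = ee ff ef fe
  have lin: "Vector_Spaces.linear scale scale (?h r)" for r
    unfolding linear_scale_iff
    by (auto intro!: vector_eq_if_B_eq simp: hyperbolic_scaling_def B_bilinear algebra_simps)
  have B_h: "B (?h r x) z = B x z + (r - 1) * B x f * B e z + (inverse r - 1) * B x e * B f z" for r x z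
    by (simp add: hyperbolic_scaling_def B_bilinear)
  have isometry: "B (?h s x) (?h s y) = B x y" for x y
  proof -
    have "B (?h s x) (?h s y) = B x y
       + (B x f * B y e + B x e * B y f) * ((s - 1) + (inverse s - 1) + (s - 1) * (inverse s - 1))"
      unfolding hyperbolic_scaling_def
      by (simp add: B_bilinear dual B_sym[of e y] B_sym[of f y] algebra_simps)
    also have "(s - 1) + (inverse s - 1) + (s - 1) * (inverse s - 1) = 0"
      using \<open>s \<noteq> 0\<close> by (simp add: field_simps)
    finally show ?thesis by simp
  qed
  have h_mult: "?h r \<circ> ?h t = ?h (r * t)" for r t
    by (rule ext, rule vector_eq_if_B_eq) (simp add: B_h B_bilinear hyperbolic_scaling_def dual algebra_simps)
  have h_one: "?h 1 = (\<lambda>x. x)" by (simp add: hyperbolic_scaling_def fun_eq_iff)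
  define \<sigma> where "\<sigma> = (\<lambda>x. x + scale (B x (e - f)) (e - f))"
  have lin_\<sigma>: "Vector_Spaces.linear scale scale \<sigma>"
    unfolding linear_scale_iff
    by (auto intro!: vector_eq_if_B_eq simp: \<sigma>_def B_bilinear algebra_simps)
  have "\<sigma> \<circ> \<sigma> = (\<lambda>x. x)"
    by (rule ext, rule vector_eq_if_B_eq) (simp add: \<sigma>_def B_bilinear dual algebra_simps)
  then have det_\<sigma>: "endo_det \<sigma> * endo_det \<sigma> = 1"
    using endo_det_compose[OF lin_\<sigma>, of \<sigma>] endo_det_id by simp
  obtain r where r: "s = r * r" using power2_csqrt[of s] by (metis power2_eq_square)
  then have "r \<noteq> 0" using \<open>s \<noteq> 0\<close> by auto
  have "\<sigma> \<circ> (?h (inverse r) \<circ> \<sigma>) = ?h r"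
    by (rule ext, rule vector_eq_if_B_eq)
       (simp add: \<sigma>_def hyperbolic_scaling_def B_bilinear dual algebra_simps)
  then have "endo_det (?h r) = endo_det \<sigma> * (endo_det (?h (inverse r)) * endo_det \<sigma>)"
    using endo_det_compose[OF lin_\<sigma>, of "?h (inverse r) \<circ> \<sigma>"] endo_det_compose[OF lin, of "inverse r" \<sigma>]
    by simp
  then have "endo_det (?h r) = endo_det (?h (inverse r))" using det_\<sigma> by (simp add: mult_ac)
  moreover have "endo_det (?h (inverse r)) * endo_det (?h r) = 1"
    using endo_det_compose[OF lin, of "inverse r" "?h r"] h_mult[of "inverse r" r] \<open>r \<noteq> 0\<close>
    by (simp add: h_one endo_det_id)
  ultimately have "endo_det (?h s) = 1"
    using endo_det_compose[OF lin, of r "?h r"] h_mult[of r r] by (simp add: r)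
  then show ?thesis using lin isometry by (simp add: SO_def)
qed

text \<open>Adjoint projections \<open>P\<close>, \<open>Q\<close> annihilating each other have isotropic images which \<open>B\<close> pairs
  perfectly. The last condition says that the one-parameter group acting with weight \<open>1\<close> on the
  image of \<open>P\<close>, weight \<open>-1\<close> on the image of \<open>Q\<close> and weight \<open>0\<close> on the common kernel lies in the
  special orthogonal group.\<close>

definition hyperbolic_projections :: "('v \<Rightarrow> 'v) \<Rightarrow> ('v \<Rightarrow> 'v) \<Rightarrow> bool" where
  "hyperbolic_projections P Q \<longleftrightarrow>
     Vector_Spaces.linear scale scale P \<and> Vector_Spaces.linear scale scale Q \<and>
     (\<forall>x y. B (P x) y = B x (Q y)) \<and>
     (\<forall>x. P (P x) = P x) \<and> (\<forall>x. Q (Q x) = Q x) \<and> (\<forall>x. Q (P x) = 0) \<and> (\<forall>x. P (Q x) = 0) \<and>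
     (\<forall>s. s \<noteq> 0 \<longrightarrow> (\<lambda>x. x + scale (s - 1) (P x) + scale (inverse s - 1) (Q x)) \<in> SO)"

lemma hyperbolic_projections_trivial: "hyperbolic_projections (\<lambda>x. 0) (\<lambda>x. 0)"
  unfolding hyperbolic_projections_def
  using linear_ident endo_det_id by (auto simp: B_zero SO_def linear_scale_iff)

text \<open>A hyperbolic pair in the weight-\<open>0\<close> space can be adjoined, as the two one-parameter groups
  commute and their product is the one-parameter group of the enlarged projections.\<close>

lemma hyperbolic_projections_extend:
  assumes PQ: "hyperbolic_projections P Q"
    and e: "P e = 0" "Q e = 0" "B e e = 0" and f: "P f = 0" "Q f = 0" "B f f = 0" and ef: "B e f = 1"
  shows "hyperbolic_projections (\<lambda>x. P x + scale (B x f) e) (\<lambda>x. Q x + scale (B x e) f)"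
proof -
  have P: "P (x + y) = P x + P y" "P (scale c x) = scale c (P x)"
    and Q: "Q (x + y) = Q x + Q y" "Q (scale c x) = scale c (Q x)" for x y c
    using PQ by (auto simp: hyperbolic_projections_def linear_scale_iff)
  have adj: "B (P x) y = B x (Q y)" for x y using PQ by (simp add: hyperbolic_projections_def)
  have adj': "B (Q x) y = B x (P y)" for x y using adj[of y x] B_sym by metis
  have fe: "B f e = 1" using ef B_sym by simp
  have orth: "B (P x) e = 0" "B (P x) f = 0" "B (Q x) e = 0" "B (Q x) f = 0" for x
    using adj adj' e f by (simp_all add: B_zero)
  have proj: "P (P x) = P x" "Q (Q x) = Q x" "Q (P x) = 0" "P (Q x) = 0" for x
    using PQ by (simp_all add: hyperbolic_projections_def)
  have SO: "(\<lambda>x. x + scale (s - 1) (P x + scale (B x f) e) + scale (inverse s - 1) (Q x + scale (B x e) f)) \<in> SO"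
    if "s \<noteq> 0" for s
  proof -
    have "(\<lambda>x. x + scale (s - 1) (P x) + scale (inverse s - 1) (Q x)) \<circ> hyperbolic_scaling e f s \<in> SO"
      using PQ that e f ef by (intro SO_compose hyperbolic_scaling_in_SO) (simp_all add: hyperbolic_projections_def)
    also have "(\<lambda>x. x + scale (s - 1) (P x) + scale (inverse s - 1) (Q x)) \<circ> hyperbolic_scaling e f s
      = (\<lambda>x. x + scale (s - 1) (P x + scale (B x f) e) + scale (inverse s - 1) (Q x + scale (B x e) f))"
    proof (rule ext)
      fix x
      have "P (hyperbolic_scaling e f s x) = P x" "Q (hyperbolic_scaling e f s x) = Q x"
        by (simp_all add: hyperbolic_scaling_def P Q e f)
      then show "((\<lambda>x. x + scale (s - 1) (P x) + scale (inverse s - 1) (Q x)) \<circ> hyperbolic_scaling e f s) x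
        = x + scale (s - 1) (P x + scale (B x f) e) + scale (inverse s - 1) (Q x + scale (B x e) f)"
        by (simp add: hyperbolic_scaling_def scale_right_distrib ac_simps)
    qed
    finally show ?thesis .
  qed
  let ?P = "\<lambda>x. P x + scale (B x f) e" and ?Q = "\<lambda>x. Q x + scale (B x e) f"
  have "Vector_Spaces.linear scale scale ?P" "Vector_Spaces.linear scale scale ?Q"
    by (simp_all add: linear_scale_iff P Q B_bilinear scale_left_distrib scale_right_distrib ac_simps)
  moreover have "B (?P x) y = B x (?Q y)" for x y
    by (simp add: B_bilinear adj B_sym[of e y])
  moreover have "?P (?P x) = ?P x" "?Q (?Q x) = ?Q x" "?Q (?P x) = 0" "?P (?Q x) = 0" for x
    by (simp_all add: P Q proj e f ef fe B_bilinear orth)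
  ultimately show ?thesis
    unfolding hyperbolic_projections_def using SO by blast
qed

text \<open>Every totally isotropic set is contained in the weight-\<open>1\<close> space of such a one-parameter
  group, and vectors orthogonal to the set have no component of weight \<open>-1\<close>. To adjoin an
  isotropic vector \<open>e\<close>, only its component \<open>e'\<close> of weight \<open>0\<close> has to be treated: it is isotropic
  again and, unless it is \<open>0\<close>, completed to a hyperbolic pair within the weight-\<open>0\<close> space.\<close>

lemma hyperbolic_projections_exist:
  assumes "finite E" and "\<And>x y. x \<in> E \<Longrightarrow> y \<in> E \<Longrightarrow> B x y = 0"
  shows "\<exists>P Q. hyperbolic_projections P Q \<and> (\<forall>x\<in>E. P x = x) \<and>
           (\<forall>x. (\<forall>e\<in>E. B x e = 0) \<longrightarrow> Q x = 0)"
  using assms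
proof (induction E rule: finite_induct)
  case empty
  then show ?case using hyperbolic_projections_trivial by (intro exI[of _ "\<lambda>x. 0"]) auto
next
  case (insert e E)
  then obtain P Q where PQ: "hyperbolic_projections P Q" and PE: "\<And>x. x \<in> E \<Longrightarrow> P x = x"
    and QE: "\<And>x. (\<forall>e\<in>E. B x e = 0) \<Longrightarrow> Q x = 0" by auto
  have adj: "B (P x) y = B x (Q y)" for x y using PQ by (simp add: hyperbolic_projections_def)
  have adj': "B (Q x) y = B x (P y)" for x y using adj[of y x] B_sym by metis
  have proj: "P (P x) = P x" "Q (Q x) = Q x" "Q (P x) = 0" "P (Q x) = 0" for x
    using PQ by (simp_all add: hyperbolic_projections_def)
  interpret P: Vector_Spaces.linear scale scale P using PQ by (simp add: hyperbolic_projections_def)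
  interpret Q: Vector_Spaces.linear scale scale Q using PQ by (simp add: hyperbolic_projections_def)
  have Qe: "Q e = 0" using insert.prems by (intro QE) auto
  define e' where "e' = e - P e"
  have Pe': "P e' = 0" and Qe': "Q e' = 0"
    by (simp_all add: e'_def P.diff Q.diff proj Qe)
  show ?case
  proof (cases "e' = 0")
    case True
    then have "P e = e" by (simp add: e'_def)
    then show ?thesis using PQ PE QE by (intro exI[of _ P] exI[of _ Q]) auto
  next
    case False
    have Pe: "B (P e) x = B e (Q x)" for x by (rule adj)
    have e'e': "B e' e' = 0"
      using insert.prems[of e e] by (simp add: e'_def B_bilinear adj B_sym[of e "P e"] Qe proj)
    obtain y where "B e' y \<noteq> 0" using False B_nondegenerate by blast
    \<comment> \<open>The weight-\<open>0\<close> component of \<open>y\<close>, normalised to pair to \<open>1\<close> with \<open>e'\<close>.\<close>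
    define z where "z = scale (inverse (B e' y)) (y - P y - Q y)"
    have Pz: "P z = 0" and Qz: "Q z = 0"
      by (simp_all add: z_def P.scale P.diff Q.scale Q.diff proj)
    have "B e' (P y) = 0" "B e' (Q y) = 0"
      using adj[of e' y] adj'[of e' y] Pe' Qe' by (simp_all add: B_zero)
    then have e'z: "B e' z = 1" using \<open>B e' y \<noteq> 0\<close> by (simp add: z_def B_bilinear)
    \<comment> \<open>Subtracting this multiple of \<open>e'\<close> makes \<open>z\<close> isotropic.\<close>
    define f where "f = z - scale (B z z / 2) e'"
    have Pf: "P f = 0" and Qf: "Q f = 0"
      by (simp_all add: f_def P.diff Q.diff P.scale Q.scale Pe' Qe' Pz Qz)
    have e'f: "B e' f = 1" using e'z by (simp add: f_def B_bilinear e'e')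
    have ff: "B f f = 0" using e'z by (simp add: f_def B_bilinear e'e' B_sym[of z e'])
    let ?P = "\<lambda>x. P x + scale (B x f) e'" and ?Q = "\<lambda>x. Q x + scale (B x e') f"
    have "hyperbolic_projections ?P ?Q"
      by (rule hyperbolic_projections_extend[OF PQ Pe' Qe' e'e' Pf Qf ff e'f])
    moreover have "B x f = 0" if "x \<in> E" for x
      using adj[of x f] PE[OF that] Qf by (simp add: B_zero)
    then have "?P x = x" if "x \<in> E" for x using PE that by simp
    moreover have "B e f = 1"
      using e'f adj[of e f] Qf by (simp add: e'_def B_bilinear)
    then have "?P e = e" by (simp add: e'_def)
    moreover have "?Q x = 0" if x: "\<forall>y\<in>insert e E. B x y = 0" for x
    proof -
      have "Q x = 0" using x by (intro QE) auto
      then have "B x (P e) = 0" using adj'[of x e] by (simp add: B_zero)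
      then show ?thesis using x \<open>Q x = 0\<close> by (simp add: e'_def B_bilinear)
    qed
    ultimately show ?thesis by (intro exI[of _ ?P] exI[of _ ?Q]) blast
  qed
qed

text \<open>If all vectors orthogonal to \<open>U\<close> were isotropic, then by polarization \<open>B\<close> would vanish on the
  orthogonal complement of \<open>U\<close>. As the whole space is the sum of this complement and \<open>span U\<close>,
  the complement would then be in the radical, hence \<open>0\<close>, and \<open>U\<close> would span.\<close>

lemma exists_unit_vector_orthogonal:
  assumes "finite U" and "card U < dim UNIV"
    and U: "\<And>x y. x \<in> U \<Longrightarrow> y \<in> U \<Longrightarrow> B x y = (if x = y then 1 else 0)"
  shows "\<exists>u. B u u = 1 \<and> (\<forall>x\<in>U. B u x = 0)"
proof -
  have "\<exists>w. B w w \<noteq> 0 \<and> (\<forall>x\<in>U. B w x = 0)"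
  proof (rule ccontr)
    assume "\<not> ?thesis"
    then have iso: "B w w = 0" if "\<forall>x\<in>U. B w x = 0" for w using that by blast
    \<comment> \<open>The projection onto the orthogonal complement of \<open>U\<close>.\<close>
    define \<pi> where "\<pi> = (\<lambda>y. y - (\<Sum>x\<in>U. scale (B y x) x))"
    have B_sum: "B (\<Sum>x\<in>R. c x) y = (\<Sum>x\<in>R. B (c x) y)" for R y and c :: "'v \<Rightarrow> 'v"
      by (induction R rule: infinite_finite_induct) (simp_all add: B_bilinear)
    have \<pi>_orth: "B (\<pi> y) x = 0" if "x \<in> U" for x y
    proof -
      have "(\<Sum>u\<in>U. B y u * B u x) = (\<Sum>u\<in>U. if u = x then B y u else 0)"
        using U that by (intro sum.cong) auto
      then show ?thesis
        using that \<open>finite U\<close> by (simp add: \<pi>_def B_bilinear B_sum)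
    qed
    have "\<pi> y = 0" for y
    proof (rule B_nondegenerate, rule allI)
      fix z
      have "B (\<pi> y + \<pi> z) (\<pi> y + \<pi> z) = 0"
        by (rule iso) (simp add: B_add \<pi>_orth)
      moreover have "B (\<pi> y) (\<pi> y) = 0" "B (\<pi> z) (\<pi> z) = 0"
        by (rule iso, simp add: \<pi>_orth)+
      ultimately have "B (\<pi> y) (\<pi> z) = 0" using B_sym[of "\<pi> z" "\<pi> y"] by (simp add: B_bilinear)
      moreover have "B (\<pi> y) (\<Sum>x\<in>U. scale (B z x) x) = 0"
        unfolding B_sym[of "\<pi> y"] B_sum B_scale using \<pi>_orth
        by (intro sum.neutral) (simp add: B_sym[of _ "\<pi> y"])
      ultimately have "B (\<pi> y) (\<pi> z + (\<Sum>x\<in>U. scale (B z x) x)) = 0" by (simp add: B_add)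
      then show "B (\<pi> y) z = 0" by (simp add: \<pi>_def)
    qed
    then have "y = (\<Sum>x\<in>U. scale (B y x) x)" for y by (simp add: \<pi>_def)
    moreover have "(\<Sum>x\<in>U. scale (B y x) x) \<in> span U" for y
      by (intro span_sum span_scale span_base)
    ultimately have "UNIV \<subseteq> span U" by (metis subsetI)
    then have "dim UNIV \<le> card U" using \<open>finite U\<close> by (intro dim_le_card)
    then show False using assms(2) by simp
  qed
  then obtain w where w: "B w w \<noteq> 0" "\<forall>x\<in>U. B w x = 0" by blast
  define c where "c = csqrt (B w w)"
  have "c * c = B w w" using power2_csqrt[of "B w w"] by (simp add: c_def power2_eq_square)
  moreover have "c \<noteq> 0" using w(1) by (simp add: c_def)
  ultimately have "inverse c * (inverse c * B w w) = 1" by (metis mult.assoc left_inverse mult_1)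
  then show ?thesis using w(2)
    by (intro exI[of _ "scale (inverse c) w"]) (simp add: B_scale)
qed

lemma orthonormal_triple_exists:
  assumes "dim UNIV \<ge> 3"
  obtains u v w where "B u u = 1" "B v v = 1" "B w w = 1" "B u v = 0" "B u w = 0" "B v w = 0"
proof -
  obtain u where u: "B u u = 1" using exists_unit_vector_orthogonal[of "{}"] assms by auto
  obtain v where v: "B v v = 1" "B v u = 0"
    using exists_unit_vector_orthogonal[of "{u}"] u assms by auto
  have "u \<noteq> v" using u v by auto
  have "B u v = 0" using v B_sym by simp
  then have "B x y = (if x = y then 1 else 0)" if "x \<in> {u, v}" "y \<in> {u, v}" for x y
    using that u v \<open>u \<noteq> v\<close> by auto
  then obtain w where w: "B w w = 1" "B w u = 0" "B w v = 0"
    using exists_unit_vector_orthogonal[of "{u, v}"] \<open>u \<noteq> v\<close> assms by auto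
  show ?thesis using that[of u v w] u v w B_sym by metis
qed

end

section \<open>Orbit cones and GIT-cones\<close>

context quadratic_space
begin

lemma poly_fun_sum:
  "(\<And>k. k \<in> K \<Longrightarrow> poly_fun (F k)) \<Longrightarrow> poly_fun (\<lambda>v. \<Sum>k\<in>K. F k v)"
  by (induction K rule: infinite_finite_induct) (simp_all add: poly_fun.const poly_fun.add)

lemma poly_fun_along_curve:
  fixes F :: "'v ^ 'm \<Rightarrow> complex"
  assumes "poly_fun F"
  shows "\<exists>p. \<forall>s. F (\<chi> i. x i + scale s (y i) + scale (s ^ 2) (z i)) = poly p s"
  using assms
proof (induction F rule: poly_fun.induct)
  case (form f i)
  then have "f (x + y) = f x + f y" "f (scale c x) = c * f x" for x y c
    by (simp_all add: Vector_Spaces.linear_iff)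
  then show ?case
    by (intro exI[of _ "[:f (x i), f (y i), f (z i):]"]) (simp add: algebra_simps power2_eq_square)
next
  case (const c)
  then show ?case by (intro exI[of _ "[:c:]"]) simp
next
  case (add F F')
  then show ?case by (metis poly_add)
next
  case (mult F F')
  then show ?case by (metis poly_mult)
qed

lemma pairing_in_multihom_inv:
  fixes i j :: "'m::finite"
  shows "(\<lambda>v. B (v $ i) (v $ j)) \<in> multihom_inv (\<chi> k. (if k = i then 1 else 0) + (if k = j then 1 else 0))"
proof -
  have expand: "B x y = (\<Sum>b\<in>Basis. representation Basis x b * B b y)" for x y
  proof -
    interpret l: Vector_Spaces.linear scale "(*)" "\<lambda>x. B x y" by (rule B_linear_left)
    have "B x y = B (\<Sum>b\<in>Basis. scale (representation Basis x b) b) y"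
      by (simp add: sum_representation_eq independent_Basis span_Basis finite_Basis)
    then show ?thesis by (simp add: l.sum l.scale)
  qed
  have eq: "(\<lambda>v::'v ^ 'm. B (v $ i) (v $ j)) =
      (\<lambda>v. \<Sum>b\<in>Basis. representation Basis (v $ i) b * B b (v $ j))"
    by (rule ext) (rule expand)
  have "poly_fun (\<lambda>v::'v ^ 'm. B (v $ i) (v $ j))"
    unfolding eq
    by (intro poly_fun_sum poly_fun.mult
        poly_fun.form[where f = "\<lambda>x. representation Basis x _"] poly_fun.form[where f = "B _"]
        linear_representation independent_Basis span_Basis B_linear_right)
  moreover have "(\<Prod>k\<in>UNIV. t k ^ ((if k = i then 1 else 0) + (if k = j then 1 else 0))) = t i * t j"
    for t :: "'m \<Rightarrow> complex"
    by (simp add: power_add prod.distrib if_distrib[of "\<lambda>n. _ ^ n"] cong: if_cong)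
  ultimately show ?thesis
    by (auto simp: multihom_inv_def multihom_def B_scale SO_def)
qed

text \<open>The Hilbert--Mumford argument that replaces a description of the ring of invariants. Let \<open>N\<close>
  be the set of indices paired nontrivially with some index of the isotropic family \<open>S\<close>.
  Multiply \<open>v $ i\<close> by \<open>1 / s\<close> for \<open>i \<in> S\<close> and by \<open>s\<close> for \<open>i \<in> N\<close>; this multiplies \<open>F\<close> by \<open>s\<close> to
  the power \<open>(\<Sum>j\<in>N. a $ j) - (\<Sum>i\<in>S. a $ i)\<close>. Follow this by the one-parameter group that scales
  the vectors in \<open>S\<close> by \<open>s\<close>. Only the vectors indexed by \<open>N\<close> can have a component of weight
  \<open>-1\<close>, and there the factor \<open>s\<close> compensates it, so the resulting point is polynomial in \<open>s\<close>.
  Were the exponent negative, invariance would make \<open>F v\<close> equal to a positive power of \<open>s\<close> times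
  a polynomial in \<open>s\<close>, hence \<open>0\<close>.\<close>

lemma isotropic_degree_le:
  fixes F :: "'v ^ 'm::finite \<Rightarrow> complex"
  assumes F: "F \<in> multihom_inv a" and Fv: "F v \<noteq> 0"
    and isotropic: "\<And>i j. i \<in> S \<Longrightarrow> j \<in> S \<Longrightarrow> B (v $ i) (v $ j) = 0"
  shows "(\<Sum>i\<in>S. a $ i) \<le> (\<Sum>j | \<exists>i\<in>S. B (v $ i) (v $ j) \<noteq> 0. a $ j)"
proof (rule ccontr)
  define N where "N = {j. \<exists>i\<in>S. B (v $ i) (v $ j) \<noteq> 0}"
  assume "\<not> ?thesis"
  then obtain d where d: "(\<Sum>i\<in>S. a $ i) = d + (\<Sum>j\<in>N. a $ j)" and "d > 0"
    by (metis N_def add.commute less_imp_add_positive not_le)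
  have disj: "i \<notin> N" if "i \<in> S" for i using isotropic that by (auto simp: N_def)
  have "\<exists>P Q. hyperbolic_projections P Q \<and> (\<forall>x\<in>($) v ` S. P x = x) \<and>
      (\<forall>x. (\<forall>e\<in>($) v ` S. B x e = 0) \<longrightarrow> Q x = 0)"
    using isotropic by (intro hyperbolic_projections_exist) auto
  then obtain P Q where PQ: "hyperbolic_projections P Q" and PS: "\<And>i. i \<in> S \<Longrightarrow> P (v $ i) = v $ i"
    and Q: "\<And>x. (\<forall>i\<in>S. B x (v $ i) = 0) \<Longrightarrow> Q x = 0" by auto
  have P_scale: "P (scale c x) = scale c (P x)" and Q_scale: "Q (scale c x) = scale c (Q x)" for c x
    using PQ by (auto simp: hyperbolic_projections_def linear_scale_iff)
  have QS: "Q (v $ i) = 0" if "i \<in> S" for i using isotropic that by (intro Q) auto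
  have QN: "Q (v $ i) = 0" if "i \<notin> N" for i
    using that B_sym by (intro Q) (auto simp: N_def)
  \<comment> \<open>The coefficients in \<open>s\<close> of the moved point: \<open>x\<close>, \<open>y\<close> and \<open>z\<close> collect degree \<open>0\<close>, \<open>1\<close> and \<open>2\<close>.\<close>
  define x where "x = (\<lambda>i. if i \<in> S then v $ i else if i \<in> N then Q (v $ i) else v $ i - P (v $ i))"
  define y where "y = (\<lambda>i. if i \<in> S then 0 else if i \<in> N then v $ i - P (v $ i) - Q (v $ i) else P (v $ i))"
  define z where "z = (\<lambda>i. if i \<in> N then P (v $ i) else 0)"
  obtain p where p: "\<And>s. F (\<chi> i. x i + scale s (y i) + scale (s ^ 2) (z i)) = poly p s"
    using poly_fun_along_curve[of F x y z] F by (auto simp: multihom_inv_def multihom_def)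
  have "s ^ d * poly p s = F v" if "s \<noteq> 0" for s
  proof -
    define t where "t = (\<lambda>i. if i \<in> S then inverse s else if i \<in> N then s else 1)"
    define g where "g = (\<lambda>x. x + scale (s - 1) (P x) + scale (inverse s - 1) (Q x))"
    have "g \<in> SO" using PQ \<open>s \<noteq> 0\<close> by (simp add: g_def hyperbolic_projections_def)
    have "g (scale (t i) (v $ i)) = x i + scale s (y i) + scale (s ^ 2) (z i)" for i
    proof (rule vector_eq_if_B_eq)
      fix w
      show "B (g (scale (t i) (v $ i))) w = B (x i + scale s (y i) + scale (s ^ 2) (z i)) w"
        using PS[of i] QS[of i] QN[of i] disj[of i] \<open>s \<noteq> 0\<close>
        by (auto simp: g_def t_def x_def y_def z_def P_scale Q_scale B_bilinear field_simps power2_eq_square)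
    qed
    then have "poly p s = F (\<chi> i. g ((\<chi> i. scale (t i) (v $ i)) $ i))"
      by (simp flip: p)
    also have "\<dots> = F (\<chi> i. scale (t i) (v $ i))"
      using F \<open>g \<in> SO\<close> unfolding multihom_inv_def by blast
    also have "\<dots> = (\<Prod>i\<in>UNIV. t i ^ (a $ i)) * F v"
      using F by (simp add: multihom_inv_def multihom_def)
    also have "(\<Prod>i\<in>UNIV. t i ^ (a $ i))
      = (\<Prod>i\<in>UNIV. (if i \<in> S then inverse s ^ (a $ i) else 1) * (if i \<in> N then s ^ (a $ i) else 1))"
      using disj by (intro prod.cong) (auto simp: t_def)
    also have "\<dots> = inverse s ^ (\<Sum>i\<in>S. a $ i) * s ^ (\<Sum>j\<in>N. a $ j)"
      by (simp add: prod.distrib power_sum flip: prod.inter_filter)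
    finally show ?thesis
      using \<open>s \<noteq> 0\<close> by (simp add: d power_add power_inverse field_simps)
  qed
  then have roots: "- {0} \<subseteq> {s. poly (monom 1 d * p - [:F v:]) s = 0}"
    by (auto simp: poly_monom)
  have "monom 1 d * p - [:F v:] = 0"
  proof (rule ccontr)
    assume "monom 1 d * p - [:F v:] \<noteq> 0"
    then have "finite (- {0::complex})" by (rule finite_subset[OF roots poly_roots_finite])
    then show False by (simp add: infinite_UNIV_char_0)
  qed
  then have "poly (monom 1 d * p - [:F v:]) 0 = 0" by simp
  then show False using Fv \<open>d > 0\<close> by (simp add: poly_monom power_0_left)
qed

text \<open>The orbit cone is the edge cone, generated by all \<open>e\<^sub>i + e\<^sub>j\<close>, of the graph (with loops) in
  which \<open>i\<close> and \<open>j\<close> are adjacent if \<open>B (v $ i) (v $ j) \<noteq> 0\<close>. Its inequalities come from the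
  stable sets: they are necessary by the degree bound for isotropic families, and for a point
  satisfying them a symmetric transport plan \<open>y\<close> writes it as the sum of \<open>y i j / 2\<close> times the
  degree of the invariant \<open>B (v $ i) (v $ j)\<close>.\<close>

theorem orbit_cone_eq:
  fixes v :: "'v ^ 'm::finite"
  shows "orbit_cone v = {x. (\<forall>i. 0 \<le> x $ i) \<and>
    (\<forall>S. (\<forall>i\<in>S. \<forall>j\<in>S. B (v $ i) (v $ j) = 0) \<longrightarrow>
      (\<Sum>i\<in>S. x $ i) \<le> (\<Sum>j | \<exists>i\<in>S. B (v $ i) (v $ j) \<noteq> 0. x $ j))}"
    (is "_ = ?C")
proof (intro equalityI subsetI)
  fix x assume x: "x \<in> orbit_cone v"
  have "(\<Sum>k\<in>{}. x $ k) \<le> (\<Sum>k\<in>{i}. x $ k)" for i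
    by (rule rat_cone_sum_le[OF x[unfolded orbit_cone_def]]) auto
  then have "0 \<le> x $ i" for i by simp
  moreover have "(\<Sum>i\<in>S. x $ i) \<le> (\<Sum>j | \<exists>i\<in>S. B (v $ i) (v $ j) \<noteq> 0. x $ j)"
    if S: "\<forall>i\<in>S. \<forall>j\<in>S. B (v $ i) (v $ j) = 0" for S
  proof (rule rat_cone_sum_le[OF x[unfolded orbit_cone_def]])
    fix q :: "rat ^ 'm"
    assume "q \<in> {\<chi> i. of_nat (a $ i) | a. \<exists>F\<in>multihom_inv a. F v \<noteq> 0}"
    then obtain a F where q: "q = (\<chi> i. of_nat (a $ i))" and F: "F \<in> multihom_inv a" "F v \<noteq> 0" by blast
    show "(\<Sum>i\<in>S. q $ i) \<le> (\<Sum>j | \<exists>i\<in>S. B (v $ i) (v $ j) \<noteq> 0. q $ j)"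
      using isotropic_degree_le[OF F, of S] S by (simp add: q flip: of_nat_sum)
  qed
  ultimately show "x \<in> ?C" by blast
next
  fix x assume x: "x \<in> ?C"
  define E where "E = {(i, j). B (v $ i) (v $ j) \<noteq> 0}"
  have "\<exists>y. (\<forall>i j. 0 \<le> y i j) \<and> (\<forall>i j. (i, j) \<notin> E \<longrightarrow> y i j = 0) \<and>
      (\<forall>i. (\<Sum>j\<in>UNIV. y i j) = x $ i) \<and> (\<forall>j. (\<Sum>i\<in>UNIV. y i j) = x $ j)"
  proof (rule symmetric_transport_plan_exists)
    show "sym E" using B_sym by (auto simp: E_def sym_def)
    show "0 \<le> x $ i" for i using x by blast
    fix S assume "S \<inter> E `` S = {}"
    then have "\<forall>i\<in>S. \<forall>j\<in>S. B (v $ i) (v $ j) = 0" by (auto simp: E_def)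
    moreover have "E `` S = {j. \<exists>i\<in>S. B (v $ i) (v $ j) \<noteq> 0}" by (auto simp: E_def)
    ultimately show "(\<Sum>i\<in>S. x $ i) \<le> (\<Sum>j\<in>E `` S. x $ j)" using x by simp
  qed
  then obtain y where y: "\<And>i j. 0 \<le> y i j" "\<And>i j. (i, j) \<notin> E \<Longrightarrow> y i j = 0"
    "\<And>i. (\<Sum>j\<in>UNIV. y i j) = x $ i" "\<And>j. (\<Sum>i\<in>UNIV. y i j) = x $ j" by blast
  \<comment> \<open>The degree of the invariant \<open>B (v $ i) (v $ j)\<close>, as the cast of a vector of naturals to match
    the generators of the orbit cone.\<close>
  define e :: "'m \<times> 'm \<Rightarrow> rat ^ 'm"
    where "e = (\<lambda>(i, j). \<chi> k. of_nat ((\<chi> k. (if k = i then 1 else 0) + (if k = j then 1 else 0)) $ k))"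
  have "x = (\<Sum>p\<in>UNIV. (case p of (i, j) \<Rightarrow> y i j / 2) *s e p)"
  proof (rule vec_eq_iff[THEN iffD2], rule allI)
    fix k
    have "(\<Sum>p\<in>UNIV. (case p of (i, j) \<Rightarrow> y i j / 2) *s e p) $ k
        = (\<Sum>i\<in>UNIV. \<Sum>j\<in>UNIV. y i j / 2 * ((if k = i then 1 else 0) + (if k = j then 1 else 0)))"
      by (simp add: sum.cartesian_product e_def case_prod_beta if_distrib[of of_nat] flip: UNIV_Times_UNIV
          cong: if_cong)
    also have "\<dots> = (\<Sum>j\<in>UNIV. y k j) / 2 + (\<Sum>i\<in>UNIV. y i k) / 2"
    proof -
      have "(\<Sum>i\<in>UNIV. \<Sum>j\<in>UNIV. y i j / 2 * (if k = i then 1 else 0))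
        = (\<Sum>i\<in>UNIV. if k = i then (\<Sum>j\<in>UNIV. y i j / 2) else 0)"
        by (intro sum.cong) auto
      then show ?thesis
        by (simp add: distrib_left sum.distrib sum_divide_distrib if_distrib[of "\<lambda>c. _ * c"] cong: if_cong)
    qed
    finally show "x $ k = (\<Sum>p\<in>UNIV. (case p of (i, j) \<Rightarrow> y i j / 2) *s e p) $ k"
      using y(3,4) by simp
  qed
  also have "\<dots> = (\<Sum>p\<in>E. (case p of (i, j) \<Rightarrow> y i j / 2) *s e p)"
    using y(2) by (intro sum.mono_neutral_right) auto
  also have "\<dots> \<in> orbit_cone v"
    unfolding orbit_cone_def
  proof (rule rat_cone_sum)
    fix p assume "p \<in> E"
    then obtain i j where p: "p = (i, j)" and ij: "B (v $ i) (v $ j) \<noteq> 0" by (auto simp: E_def)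
    show "0 \<le> (case p of (i, j) \<Rightarrow> y i j / 2)" using y(1) by (simp add: p)
    show "e p \<in> {\<chi> i. of_nat (a $ i) | a. \<exists>F\<in>multihom_inv a. F v \<noteq> 0}"
      unfolding p e_def prod.case mem_Collect_eq
      by (intro exI conjI, rule refl, rule bexI[where x = "\<lambda>v. B (v $ i) (v $ j)"])
         (rule ij, rule pairing_in_multihom_inv)
  qed simp
  finally show "x \<in> orbit_cone v" .
qed

lemma weight_cone_eq:
  assumes "dim UNIV \<ge> 3"
  shows "weight_cone = {x :: rat ^ 'm::finite. \<forall>i. 0 \<le> x $ i}"
proof (intro equalityI subsetI CollectI)
  fix x :: "rat ^ 'm" assume x: "x \<in> weight_cone"
  have "(\<Sum>k\<in>{}. x $ k) \<le> (\<Sum>k\<in>{i}. x $ k)" for i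
    by (rule rat_cone_sum_le[OF x[unfolded weight_cone_def]]) auto
  then show "\<forall>i. 0 \<le> x $ i" by simp
next
  fix x :: "rat ^ 'm" assume x: "x \<in> {x. \<forall>i. 0 \<le> x $ i}"
  obtain u where u: "B u u = 1" using orthonormal_triple_exists[OF assms] by blast
  have "x \<in> orbit_cone (\<chi> i. u)" using x by (auto simp: orbit_cone_eq u)
  moreover have "F \<noteq> (\<lambda>v. 0)" if "F y \<noteq> 0" for F :: "'v ^ 'm \<Rightarrow> complex" and y
    using that by auto
  then have "orbit_cone (\<chi> i. u) \<subseteq> (weight_cone :: (rat ^ 'm) set)"
    unfolding orbit_cone_def weight_cone_def by (intro rat_cone_mono) blast
  ultimately show "x \<in> weight_cone" by blast
qed

text \<open>Every inequality defining an orbit cone compares the sums over a stable set and over its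
  neighbourhood, which are disjoint; this gives one inclusion. For the other, every inequality
  of the sign cone has to be produced by an orbit cone containing \<open>a\<close>. Given an orthonormal
  triple \<open>u\<close>, \<open>v\<close>, \<open>w\<close>, this is done by the point with the isotropic vector \<open>u + \<i> v\<close> at the
  places in \<open>I\<close>, with \<open>u\<close> at those in \<open>J\<close> and with \<open>w\<close>, orthogonal to \<open>u + \<i> v\<close>, elsewhere: all
  constraints of its orbit cone follow from nonnegativity and the one comparing \<open>I\<close> with \<open>J\<close>.
  The three vectors are the reason for asking for dimension at least three.\<close>

lemma git_cone_eq_sign_cone:
  fixes a :: "rat ^ 'm::finite"
  assumes dim: "dim UNIV \<ge> 3" and a: "\<And>i. 0 \<le> a $ i"
  shows "git_cone a = sign_cone a"
proof (intro equalityI subsetI)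
  fix x assume x: "x \<in> git_cone a"
  obtain u v w where orthonormal: "B u u = 1" "B v v = 1" "B w w = 1" "B u v = 0" "B u w = 0" "B v w = 0"
    using orthonormal_triple_exists[OF dim] by blast
  have "(\<Sum>i\<in>I. x $ i) \<le> (\<Sum>j\<in>J. x $ j)"
    if IJ: "I \<inter> J = {}" and le: "(\<Sum>i\<in>I. a $ i) \<le> (\<Sum>j\<in>J. a $ j)" for I J
  proof -
    define e where "e = u + scale \<i> v"
    define y :: "'v ^ 'm" where "y = (\<chi> k. if k \<in> I then e else if k \<in> J then u else w)"
    have B_e: "B e e = 0" "B e u = 1" "B e w = 0"
      using orthonormal B_sym[of v u] by (simp_all add: e_def B_bilinear)
    have isotropic: "S \<subseteq> I" if "\<forall>i\<in>S. \<forall>j\<in>S. B (y $ i) (y $ j) = 0" for S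
      using that orthonormal by (auto simp: y_def split: if_splits)
    have neighbours: "{j. \<exists>i\<in>S. B (y $ i) (y $ j) \<noteq> 0} = (if S = {} then {} else J)" if "S \<subseteq> I" for S
      using that IJ by (auto simp: y_def B_e split: if_splits)
    have "a \<in> orbit_cone y"
      unfolding orbit_cone_eq
    proof (intro CollectI conjI allI impI a)
      fix S assume "\<forall>i\<in>S. \<forall>j\<in>S. B (y $ i) (y $ j) = 0"
      then have "S \<subseteq> I" by (rule isotropic)
      have "(\<Sum>i\<in>S. a $ i) \<le> (\<Sum>i\<in>I. a $ i)"
        using a \<open>S \<subseteq> I\<close> by (intro sum_mono2) auto
      then show "(\<Sum>i\<in>S. a $ i) \<le> (\<Sum>j | \<exists>i\<in>S. B (y $ i) (y $ j) \<noteq> 0. a $ j)"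
        using le by (auto simp: neighbours[OF \<open>S \<subseteq> I\<close>])
    qed
    then have "x \<in> orbit_cone y" using x unfolding git_cone_def by blast
    then have x0: "\<forall>i. 0 \<le> x $ i" and xS: "\<And>S. \<forall>i\<in>S. \<forall>j\<in>S. B (y $ i) (y $ j) = 0 \<Longrightarrow>
      (\<Sum>i\<in>S. x $ i) \<le> (\<Sum>j | \<exists>i\<in>S. B (y $ i) (y $ j) \<noteq> 0. x $ j)"
      unfolding orbit_cone_eq by blast+
    have "(\<Sum>i\<in>I. x $ i) \<le> (\<Sum>j\<in>(if I = {} then {} else J). x $ j)"
      using xS[of I] neighbours[of I] by (simp add: y_def B_e)
    then show ?thesis using x0 by (cases "I = {}") (auto intro: sum_nonneg)
  qed
  then show "x \<in> sign_cone a" by (simp add: sign_cone_def)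
next
  fix x assume x: "x \<in> sign_cone a"
  have "x \<in> orbit_cone v" if av: "a \<in> orbit_cone v" for v :: "'v ^ 'm"
    unfolding orbit_cone_eq
  proof (intro CollectI conjI allI impI)
    show "0 \<le> x $ i" for i using sign_cone_nonneg[OF x a] .
    fix S assume S: "\<forall>i\<in>S. \<forall>j\<in>S. B (v $ i) (v $ j) = 0"
    show "(\<Sum>i\<in>S. x $ i) \<le> (\<Sum>j | \<exists>i\<in>S. B (v $ i) (v $ j) \<noteq> 0. x $ j)"
    proof (rule sign_coneD[OF x])
      show "S \<inter> {j. \<exists>i\<in>S. B (v $ i) (v $ j) \<noteq> 0} = {}" using S by blast
      show "(\<Sum>i\<in>S. a $ i) \<le> (\<Sum>j | \<exists>i\<in>S. B (v $ i) (v $ j) \<noteq> 0. a $ j)"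
        using av S unfolding orbit_cone_eq by blast
    qed
  qed
  then show "x \<in> git_cone a" unfolding git_cone_def by blast
qed

end

section \<open>The GIT-fan\<close>

theorem theorem2:
  fixes scale :: "complex \<Rightarrow> 'v::ab_group_add \<Rightarrow> 'v"
    and Basis :: "'v set"
    and B :: "'v \<Rightarrow> 'v \<Rightarrow> complex"
    and \<Omega> :: "(rat ^ 'm::finite) set"
  assumes "quadratic_space scale Basis B"
    and "vector_space.dim scale (UNIV :: 'v set) \<ge> 3"
    and "\<Omega> = {x. \<forall>i. 0 \<le> x $ i}"
  shows "quadratic_space.weight_cone scale Basis B = \<Omega> \<and>
         quadratic_space.git_fan scale Basis B =
           cut_fan \<Omega> {(\<lambda>x. (\<Sum>i\<in>I. x $ i) - (\<Sum>j\<in>J. x $ j)) | I J.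
                        I \<noteq> {} \<and> J \<noteq> {} \<and> I \<inter> J = {}}"
proof -
  interpret quadratic_space scale Basis B by fact
  have weight: "weight_cone = \<Omega>" using weight_cone_eq assms(2,3) by simp
  have "git_fan = {sign_cone a | a. a \<in> \<Omega>}"
    unfolding git_fan_def weight using git_cone_eq_sign_cone[OF assms(2)]
    by (auto simp: assms(3) intro!: Collect_cong)
  then show ?thesis
    using weight sign_cones_eq_cut_fan[where 'm = 'm] by (simp add: assms(3))
qed

end
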